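(* If $f(z)=z+a_2z^2+\cdots\in\mathcal{C}$, then $f\in\mathcal{S}^*(\alpha)$, where $\alpha$ is the smallest positive root of the equation $$2\alpha^3-\alpha^2|a_2|-4\alpha+2=0$$ in the interval $[1/2,2/3]$.
   Context: $\mathbb{D}=\{z\in\mathbb{C}:|z|<1\}$. $\mathcal{A}$ is the class of analytic functions $f$ in $\mathbb{D}$ of the form $f(z)=z+a_2z^2+a_3z^3+\cdots$. $\mathcal{C}$ (convex functions) is the class of $f\in\mathcal{A}$ with $\operatorname{Re}\left(1+\frac{zf''(z)}{f'(z)}\right)>0$ for all $z\in\mathbb{D}$. For $0\le\alpha<1$, $\mathcal{S}^*(\alpha)$ (starlike functions of order $\alpha$) is the class of $f\in\mathcal{A}$ with $\operatorname{Re}\left(\frac{zf'(z)}{f(z)}\right)>\alpha$ for all $z\in\mathbb{D}$. *)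

theory Defs
  imports "HOL-Complex_Analysis.Complex_Analysis"
begin

text \<open>Functions on the unit disc are total functions on the complex plane; their values outside
  the disc play no role in any definition below.\<close>

abbreviation unit_disc :: "complex set" where
  "unit_disc \<equiv> ball 0 1"

text \<open>The expansion $f(z) = z + a_2 z^2 + a_3 z^3 + \cdots$ on the disc.\<close>

definition normalized_expansion :: "(complex \<Rightarrow> complex) \<Rightarrow> (nat \<Rightarrow> complex) \<Rightarrow> bool" where
  "normalized_expansion f a \<longleftrightarrow>
     a 0 = 0 \<and> a 1 = 1 \<and> (\<forall>z\<in>unit_disc. (\<lambda>n. a n * z ^ n) sums f z)"

definition normalized_functions :: "(complex \<Rightarrow> complex) set" where
  "normalized_functions =
     {f. f analytic_on unit_disc \<and> (\<exists>a. normalized_expansion f a)}"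

text \<open>Because division by zero yields zero, the conditions that the quotients below be defined
  are stated explicitly.\<close>

definition convex_functions :: "(complex \<Rightarrow> complex) set" where
  "convex_functions =
     {f \<in> normalized_functions. \<forall>z\<in>unit_disc.
        deriv f z \<noteq> 0 \<and> Re (1 + z * deriv (deriv f) z / deriv f z) > 0}"

text \<open>At the origin $z f'(z) / f(z)$ has a removable singularity with value $1$, where the
  condition reads $1 > \alpha$. The class is meant for $0 \le \alpha < 1$, so the origin is
  left out.\<close>

definition starlike_functions :: "real \<Rightarrow> (complex \<Rightarrow> complex) set" where
  "starlike_functions \<alpha> =
     {f \<in> normalized_functions. \<forall>z\<in>unit_disc - {0}.
        f z \<noteq> 0 \<and> Re (z * deriv f z / f z) > \<alpha>}"

end

theory Submission
  imports Defs
begin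

text \<open>For convex $f$ the quotient $u(z) = f(z)/(z f'(z))$ is holomorphic on the disc, because $f'$ has
  no zeros, and $P u = 1 - z u'$ with $P = 1 + z f''/f'$. Starlikeness of order $\alpha$ says
  that $w = (1-u)/(1+(1-2\alpha)u)$ maps the disc into itself. If it does not, let $z_0$ be a point
  of least modulus with $|w(z_0)| = 1$. Jack's lemma, sharpened by the Schwarz lemma with
  prescribed $w'(0)$, gives $z_0 w'(z_0) = m w(z_0)$ with real $m \ge 2/(1+|w'(0)|)$, where
  $|w'(0)| = |a_2|/(2(1-\alpha))$. This forces $\mathrm{Re}\, P(z_0) \le \alpha -
  m(1-\alpha)/(2\alpha)$, and the cubic equation is exactly the condition that makes the bound
  nonpositive.\<close>

section \<open>Schwarz-Pick at the origin and the Schwarz lemma with prescribed derivative\<close>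

lemma norm_pseudo_hyperbolic_diff:
  "(norm (1 - cnj w * v))\<^sup>2 - (norm (v - w :: complex))\<^sup>2 = (1 - (norm w)\<^sup>2) * (1 - (norm v)\<^sup>2)"
  unfolding cmod_power2 by (simp add: power2_eq_square algebra_simps)

text \<open>The extreme case is that of \<open>v\<close> and \<open>w\<close> on the same ray. By
  the identity above, the hypothesis reads (1 - r^2) |1 - cnj w v|^2 \<le> (1 - |w|^2)(1 - |v|^2).
  Replacing |1 - cnj w v| by its lower bound 1 - |w||v| leaves the same inequality for the reals |v|
  and |w|, which solves for |v|.\<close>

lemma norm_le_of_pseudo_hyperbolic_le:
  fixes v w :: complex
  assumes "norm v < 1" "norm w < 1" "0 \<le> r" "r < 1"
    and le: "norm (v - w) \<le> r * norm (1 - cnj w * v)"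
  shows "norm v \<le> (r + norm w) / (1 + norm w * r)"
proof -
  let ?x = "norm v" and ?c = "norm w" and ?D = "norm (1 - cnj w * v)"
  have id: "?D\<^sup>2 - (norm (v - w))\<^sup>2 = (1 - ?c\<^sup>2) * (1 - ?x\<^sup>2)"
    by (rule norm_pseudo_hyperbolic_diff)
  have "?c * ?x < 1"
    using assms(1,2) by (metis norm_ge_zero mult_strict_mono' mult_1)
  then have cx: "0 < 1 - ?c * ?x" by simp
  have "1 - ?c * ?x \<le> ?D"
    using norm_triangle_ineq2[of 1 "cnj w * v"] by (simp add: norm_mult)
  with cx have D2: "(1 - ?c * ?x)\<^sup>2 \<le> ?D\<^sup>2"
    by (intro power_mono) auto
  have "(norm (v - w))\<^sup>2 \<le> r\<^sup>2 * ?D\<^sup>2"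
    using power_mono[OF le norm_ge_zero, of 2] by (simp add: power_mult_distrib)
  with id have "(1 - r\<^sup>2) * ?D\<^sup>2 \<le> (1 - ?c\<^sup>2) * (1 - ?x\<^sup>2)"
    by (simp add: algebra_simps)
  moreover have "(1 - r\<^sup>2) * (1 - ?c * ?x)\<^sup>2 \<le> (1 - r\<^sup>2) * ?D\<^sup>2"
    using D2 assms(3,4) by (intro mult_left_mono) (auto simp: power_le_one)
  ultimately have "(1 - r\<^sup>2) * (1 - ?c * ?x)\<^sup>2 \<le> (1 - ?c\<^sup>2) * (1 - ?x\<^sup>2)" by linarith
  then have "(?x - ?c)\<^sup>2 \<le> (r * (1 - ?c * ?x))\<^sup>2"
    by (simp add: power2_eq_square algebra_simps)
  then have "?x - ?c \<le> r * (1 - ?c * ?x)"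
    by (rule power2_le_imp_le) (use assms cx in simp)
  moreover have "0 < 1 + ?c * r"
    using assms(3) by (intro add_pos_nonneg) auto
  ultimately show ?thesis
    by (simp add: pos_le_divide_eq algebra_simps)
qed

text \<open>The disc automorphism sending \<open>f 0\<close> to 0 is applied after \<open>f\<close>.
  The Schwarz lemma bounds the composite \<open>g\<close>, and the previous lemma converts this
  pseudo-hyperbolic bound into one on |f z|.\<close>

lemma Schwarz_Pick_at_0:
  assumes holf: "f holomorphic_on ball 0 1"
    and lt: "\<And>z. norm z < 1 \<Longrightarrow> norm (f z) < 1"
    and z: "norm z < 1"
  shows "norm (f z) \<le> (norm z + norm (f 0)) / (1 + norm (f 0) * norm z)"
proof -
  define g where "g z = (f z - f 0) / (1 - cnj (f 0) * f z)" for z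
  have small: "norm (cnj (f 0) * f x) < 1" if "norm x < 1" for x
    using mult_strict_mono'[OF lt[of 0] lt[OF that]] by (simp add: norm_mult)
  have nz: "1 - cnj (f 0) * f x \<noteq> 0" if "norm x < 1" for x
    using small[OF that] by auto
  have "norm (g z) \<le> norm z"
  proof (rule Schwarz_Lemma(1))
    show "g holomorphic_on ball 0 1"
      unfolding g_def using holf nz by (intro holomorphic_intros) auto
    show "g 0 = 0" by (simp add: g_def)
    show "norm z < 1" by (fact z)
    fix x :: complex assume x: "norm x < 1"
    have "(norm (1 - cnj (f 0) * f x))\<^sup>2 - (norm (f x - f 0))\<^sup>2
        = (1 - (norm (f 0))\<^sup>2) * (1 - (norm (f x))\<^sup>2)"
      by (rule norm_pseudo_hyperbolic_diff)
    moreover have "0 < (1 - (norm (f 0))\<^sup>2) * (1 - (norm (f x))\<^sup>2)"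
      using lt[of 0] lt[OF x] by (intro mult_pos_pos) (auto simp: power_less_one_iff abs_square_less_1)
    ultimately have "(norm (f x - f 0))\<^sup>2 < (norm (1 - cnj (f 0) * f x))\<^sup>2" by linarith
    then have "norm (f x - f 0) < norm (1 - cnj (f 0) * f x)"
      by (rule power2_less_imp_less) simp
    with nz[OF x] show "norm (g x) < 1"
      by (simp add: g_def norm_divide)
  qed
  then have "norm (f z - f 0) \<le> norm z * norm (1 - cnj (f 0) * f z)"
    using nz[OF z] by (simp add: g_def norm_divide divide_le_eq)
  then show ?thesis
    using lt[of 0] lt[OF z] z by (intro norm_le_of_pseudo_hyperbolic_le) auto
qed

text \<open>Write \<open>f z = z * h z\<close> with \<open>h 0 = deriv f 0\<close> and apply
  Schwarz-Pick to \<open>h\<close>, which maps the disc into itself unless \<open>f\<close> is a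
  rotation.\<close>

lemma Schwarz_Lemma_refined:
  assumes holf: "f holomorphic_on ball 0 1" and f0: "f 0 = 0"
    and lt: "\<And>z. norm z < 1 \<Longrightarrow> norm (f z) < 1"
    and z: "norm z < 1"
  shows "norm (f z) \<le> norm z * (norm z + norm (deriv f 0)) / (1 + norm (deriv f 0) * norm z)"
proof -
  obtain h where h: "h holomorphic_on ball 0 1" "\<And>z. norm z < 1 \<Longrightarrow> f z = z * h z" "deriv f 0 = h 0"
    using Schwarz3[OF holf f0] by metis
  have le1: "norm (h 0) \<le> 1"
    using Schwarz_Lemma(2)[OF holf f0 lt z] h(3) by simp
  have "norm (h z) \<le> (norm z + norm (h 0)) / (1 + norm (h 0) * norm z)"
  \<comment> \<open>The first case is equality in the Schwarz lemma: \<open>f\<close> is a rotation,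
    \<open>h\<close> has modulus 1, and the right-hand side collapses to 1.\<close>
  proof (cases "(\<exists>z. norm z < 1 \<and> z \<noteq> 0 \<and> norm (f z) = norm z) \<or> norm (deriv f 0) = 1")
    case True
    then obtain c where c: "\<And>z. norm z < 1 \<Longrightarrow> f z = c * z" "norm c = 1"
      using Schwarz_Lemma'[OF holf f0 lt] by blast
    have "(f has_field_derivative c) (at 0)"
      by (rule has_field_derivative_transform_within_open[of "\<lambda>z. c * z" _ _ "ball 0 1"])
        (auto intro!: derivative_eq_intros simp: c)
    then have d: "norm (h 0) = 1"
      using c(2) h(3) by (simp add: DERIV_imp_deriv)
    moreover have "norm (h z) \<le> 1"
      using c(1)[of z] h(2)[OF z] d z c(2) by (cases "z = 0") auto
    moreover have "0 < 1 + norm z"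
      by (simp add: add_pos_nonneg)
    ultimately show ?thesis by (simp add: add.commute)
  next
    case False
    have "norm (h x) < 1" if x: "norm x < 1" for x
    proof (cases "x = 0")
      case True
      then show ?thesis using False le1 h(3) by auto
    next
      case nz: False
      have "norm (f x) \<le> norm x"
        using Schwarz_Lemma(1)[OF holf f0 lt x] .
      with False nz x have "norm (f x) < norm x" by force
      with nz h(2)[OF x] show ?thesis by (simp add: norm_mult)
    qed
    then show ?thesis using Schwarz_Pick_at_0[OF h(1) _ z] by blast
  qed
  then have "norm z * norm (h z) \<le> norm z * ((norm z + norm (h 0)) / (1 + norm (h 0) * norm z))"
    by (rule mult_left_mono) simp
  then show ?thesis
    using h(2)[OF z] h(3) by (simp add: norm_mult)
qed

section \<open>Jack's lemma with a bound depending on the derivative at 0\<close>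

text \<open>Along the circle |f| peaks at 1, so the logarithmic derivative there is real. Along the
  radius |f| stays below the majorant t(t+c)/(1+ct) of the refined Schwarz lemma and meets it at t =
  1, where the majorant has slope 2/(1+c).\<close>

lemma Jack_lemma_at_1:
  assumes holf: "f holomorphic_on S" and S: "open S" "cball 0 1 \<subseteq> S"
    and f0: "f 0 = 0"
    and lt: "\<And>z. norm z < 1 \<Longrightarrow> norm (f z) < 1"
    and f1: "norm (f 1) = 1"
  obtains m :: real where "m \<ge> 2 / (1 + norm (deriv f 0))" "deriv f 1 = of_real m * f 1"
proof -
  define c where "c = norm (deriv f 0)"
  \<comment> \<open>As |f 1| = 1, multiplying by \<open>cnj (f 1)\<close> is dividing by
    \<open>f 1\<close>, so \<open>k\<close> is the logarithmic derivative of \<open>f\<close> at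
    1.\<close>
  define k where "k = cnj (f 1) * deriv f 1"
  have c: "0 \<le> c" by (simp add: c_def)
  have holB: "f holomorphic_on ball 0 1"
    using holf S(2) ball_subset_cball holomorphic_on_subset by blast
  have one: "cnj (f 1) * f 1 = 1"
    using f1 complex_norm_square[of "f 1"] by (simp add: mult.commute)
  have d1: "(f has_field_derivative deriv f 1) (at 1)"
    using holf S by (intro holomorphic_derivI) auto
  have le1: "norm (f z) \<le> 1" if "norm z \<le> 1" for z
  proof (rule continuous_le_on_closure[of "ball 0 1" "\<lambda>z. norm (f z)"])
    show "continuous_on (closure (ball 0 1)) (\<lambda>z. norm (f z))"
      using holf S(2)
      by (auto intro!: continuous_intros intro: continuous_on_subset holomorphic_on_imp_continuous_on)
  qed (use that lt in \<open>auto intro: less_imp_le\<close>)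
  \<comment> \<open>\<open>Re (cnj (f 1) * f z)\<close> is a differentiable stand-in for |f z|: it
    lies below |f z| and agrees with it at z = 1.\<close>
  have Re_le: "Re (cnj (f 1) * f z) \<le> norm (f z)" for z
    using complex_Re_le_cmod[of "cnj (f 1) * f z"] f1 by (simp add: norm_mult)
  have D1: "((\<lambda>z. cnj (f 1) * f z) has_field_derivative k) (at 1)"
    unfolding k_def by (intro DERIV_cmult d1)

  \<comment> \<open>$t \mapsto |f(e^{it})|$ is maximal at $0$, so $k$ is real.\<close>
  have "((\<lambda>t. cnj (f 1) * f (cis t)) has_vector_derivative (\<i> * k)) (at 0)"
  proof -
    have "(cis has_vector_derivative \<i>) (at 0)"
      by (auto simp: has_vector_derivative_complex_iff intro!: derivative_eq_intros)
    from field_vector_diff_chain_at[OF this, of "\<lambda>z. cnj (f 1) * f z" k] D1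
    show ?thesis by (simp add: o_def)
  qed
  then have "((\<lambda>t. Re (cnj (f 1) * f (cis t))) has_real_derivative Re (\<i> * k)) (at 0)"
    by (simp add: has_real_derivative_iff_has_vector_derivative has_vector_derivative_complex_iff)
  then have "Re (\<i> * k) = 0"
  proof (rule DERIV_local_max[of _ _ _ 1])
    show "\<forall>y. \<bar>0 - y\<bar> < 1 \<longrightarrow> Re (cnj (f 1) * f (cis y)) \<le> Re (cnj (f 1) * f (cis 0))"
    proof (intro allI impI)
      fix y :: real
      have "norm (f (cis y)) \<le> 1" by (intro le1) simp
      then show "Re (cnj (f 1) * f (cis y)) \<le> Re (cnj (f 1) * f (cis 0))"
        unfolding cis_zero one using Re_le[of "cis y"] by simp
    qed
  qed simp
  then have Im: "Im k = 0" by simp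

  have radial: "((\<lambda>t. Re (cnj (f 1) * f (of_real t))) has_real_derivative Re k) (at 1)"
  proof -
    have "((\<lambda>t. cnj (f 1) * f (of_real t)) has_vector_derivative k) (at 1)"
      using has_vector_derivative_real_field[of "\<lambda>z. cnj (f 1) * f z" k 1 UNIV] D1 by simp
    then show ?thesis
      by (simp add: has_real_derivative_iff_has_vector_derivative has_vector_derivative_complex_iff)
  qed
  \<comment> \<open>The refined Schwarz bound is attained at $1$, so comparing slopes there bounds $k$ from below.\<close>
  define H where "H t = t * (t + c) / (1 + c * t) - Re (cnj (f 1) * f (of_real t))" for t :: real
  have "((\<lambda>t. t * (t + c) / (1 + c * t)) has_real_derivative 2 / (1 + c)) (at 1)"
  proof -
    have "0 < 1 + (c * c + c * 2)" using c by (intro add_pos_nonneg) auto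
    then show ?thesis
      using c by (auto intro!: derivative_eq_intros simp: field_simps power2_eq_square)
  qed
  from DERIV_diff[OF this radial]
  have H': "(H has_real_derivative (2 / (1 + c) - Re k)) (at 1)"
    by (simp add: H_def[abs_def])
  have H1: "H 1 = 0"
    using c one by (simp add: H_def)
  have "\<not> 0 < 2 / (1 + c) - Re k"
  proof
    assume "0 < 2 / (1 + c) - Re k"
    from DERIV_pos_inc_left[OF H' this] obtain d
      where d: "d > 0" "\<And>h. h > 0 \<Longrightarrow> h < d \<Longrightarrow> H (1 - h) < 0"
      using H1 by auto
    \<comment> \<open>The minimum keeps \<open>t\<close> within \<open>d\<close> of 1 and inside
      (0,1), where the refined Schwarz bound contradicts \<open>H t < 0\<close>.\<close>
    define t where "t = 1 - min (d / 2) (1 / 2)"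
    have t: "0 < t" "t < 1" using d(1) by (auto simp: t_def)
    have "H t < 0" unfolding t_def using d(1) by (intro d(2)) auto
    have "norm (f (of_real t)) \<le> t * (t + c) / (1 + c * t)"
      using Schwarz_Lemma_refined[OF holB f0 lt, of "of_real t"] t by (simp add: c_def)
    then show False
      using \<open>H t < 0\<close> Re_le[of "of_real t"] by (simp add: H_def)
  qed
  then have "Re k \<ge> 2 / (1 + norm (deriv f 0))"
    by (simp add: c_def)
  moreover have "deriv f 1 = of_real (Re k) * f 1"
  proof -
    have "of_real (Re k) = k"
      using Im by (simp add: complex_eq_iff)
    then show ?thesis
      using one by (metis k_def mult.assoc mult.commute mult.right_neutral)
  qed
  ultimately show thesis by (rule that)
qed

text \<open>Rescaling by \<open>z0\<close> moves the contact point to 1. The chain rule turns the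
  derivative at 0 into \<open>z0 * deriv f 0\<close>, whence the factor \<open>norm z0\<close> in
  the bound.\<close>

lemma Jack_lemma_second_coefficient:
  assumes holf: "f holomorphic_on S" and S: "open S" "cball 0 (norm z0) \<subseteq> S"
    and z0: "z0 \<noteq> 0" and f0: "f 0 = 0"
    and lt: "\<And>z. norm z < norm z0 \<Longrightarrow> norm (f z) < 1"
    and f1: "norm (f z0) = 1"
  obtains m :: real where "m \<ge> 2 / (1 + norm z0 * norm (deriv f 0))" "z0 * deriv f z0 = of_real m * f z0"
proof -
  define g where "g z = f (z0 * z)" for z
  define T where "T = (\<lambda>z. z0 * z) -` S"
  have T: "open T" unfolding T_def
    by (rule open_vimage[OF S(1)]) (intro continuous_intros)
  have sub: "cball 0 1 \<subseteq> T"
    using S(2) z0 by (auto simp: T_def norm_mult mult_left_le subset_iff)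
  have der: "deriv g z = z0 * deriv f (z0 * z)" if "z \<in> T" for z
  proof -
    have "(f has_field_derivative deriv f (z0 * z)) (at (z0 * z))"
      using holf S(1) that by (intro holomorphic_derivI) (auto simp: T_def)
    then have "((\<lambda>z. f (z0 * z)) has_field_derivative (deriv f (z0 * z) * z0)) (at z)"
      by (rule DERIV_chain2) (auto intro!: derivative_eq_intros)
    then show ?thesis
      by (simp add: g_def[abs_def] DERIV_imp_deriv mult.commute)
  qed
  have "g holomorphic_on T"
    unfolding g_def
    by (rule holomorphic_on_compose_gen[where g = f and t = S and f = "\<lambda>z. z0 * z", unfolded o_def])
      (auto intro!: holomorphic_intros holf simp: T_def)
  moreover have "norm (g z) < 1" if "norm z < 1" for z
    unfolding g_def using that z0 by (intro lt) (simp add: norm_mult)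
  ultimately obtain m :: real
    where m: "m \<ge> 2 / (1 + norm (deriv g 0))" "deriv g 1 = of_real m * g 1"
    using Jack_lemma_at_1[of g T] T sub f0 f1 by (auto simp: g_def)
  show thesis
  proof (rule that)
    have "0 \<in> T" "1 \<in> T" using sub by auto
    with m der show "m \<ge> 2 / (1 + norm z0 * norm (deriv f 0))" "z0 * deriv f z0 = of_real m * f z0"
      by (auto simp: norm_mult g_def)
  qed
qed

section \<open>Functions with positive real part\<close>

text \<open>The Cayley transform (P - 1)/(P + 1) maps the disc into itself, fixes 0 and has
  derivative P'(0)/2 there, so the Schwarz lemma applies. For P = 1 + z f''/f' this gives |a_2|
  \<le> 1.\<close>

lemma Caratheodory_coefficient_bound:
  assumes holP: "P holomorphic_on ball 0 1" and P0: "P 0 = 1"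
    and pos: "\<And>z. norm z < 1 \<Longrightarrow> 0 < Re (P z)"
  shows "norm (deriv P 0) \<le> 2"
proof -
  define q where "q z = (P z - 1) / (P z + 1)" for z
  have nz: "P z + 1 \<noteq> 0" if "norm z < 1" for z
    using pos[OF that] by (auto simp: complex_eq_iff)
  have hq: "q holomorphic_on ball 0 1"
    unfolding q_def using holP nz by (intro holomorphic_intros) auto
  have lt: "norm (q z) < 1" if "norm z < 1" for z
  proof -
    have "(norm (P z - 1))\<^sup>2 < (norm (P z + 1))\<^sup>2"
      using pos[OF that] unfolding cmod_power2 by (simp add: power2_eq_square algebra_simps)
    then have "norm (P z - 1) < norm (P z + 1)"
      by (rule power2_less_imp_less) simp
    with nz[OF that] show ?thesis by (simp add: q_def norm_divide)
  qed
  have "(P has_field_derivative deriv P 0) (at 0)"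
    using holP by (intro holomorphic_derivI) auto
  then have "(q has_field_derivative (deriv P 0 / 2)) (at 0)"
    unfolding q_def using P0 by (auto intro!: derivative_eq_intros)
  then have "norm (deriv q 0) = norm (deriv P 0) / 2"
    by (simp add: DERIV_imp_deriv norm_divide)
  moreover have "norm (deriv q 0) \<le> 1"
  proof (rule Schwarz_Lemma(2)[OF hq])
    show "q 0 = 0" "norm (0 :: complex) < 1" using P0 by (simp_all add: q_def)
  qed (fact lt)
  ultimately show ?thesis by linarith
qed

section \<open>Estimate of Re P at the contact point\<close>

text \<open>Here $s = 1 - 2\alpha$, so that $\alpha = (1-s)/2$, and $w$ is the point on the unit circle
  with $u = (1-w)/(1+sw)$.\<close>

lemma Re_boundary_le:
  fixes w P :: complex and s m :: real
  assumes "norm w = 1" "w \<noteq> 1" and s: "-1 < s" "s \<le> 0" and "0 \<le> m"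
    and P: "P * ((1 - w) / (1 + of_real s * w))
              = 1 + of_real m * w * (1 + of_real s) / (1 + of_real s * w)\<^sup>2"
  shows "Re P \<le> (1 - s) / 2 - m * (1 + s) / (2 * (1 - s))"
proof -
  have w1: "(Re w)\<^sup>2 + (Im w)\<^sup>2 = 1"
    using assms(1) by (simp add: cmod_def)
  have Rew: "Re w < 1"
  proof (rule ccontr)
    assume "\<not> Re w < 1"
    moreover have "Re w \<le> 1" using complex_Re_le_cmod[of w] assms(1) by simp
    ultimately have "Re w = 1" by simp
    with w1 have "Im w = 0" by simp
    with \<open>Re w = 1\<close> assms(2) show False by (simp add: complex_eq_iff)
  qed
  have Rew': "-1 \<le> Re w"
    using abs_Re_le_cmod[of w] assms(1) by simp
  have nz1: "1 - w \<noteq> 0" using assms(2) by simp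
  have "norm (of_real s * w) < 1"
    using s assms(1) by (simp add: norm_mult)
  then have nz2: "1 + of_real s * w \<noteq> 0"
    by (metis add_eq_0_iff2 norm_minus_cancel norm_one order_less_irrefl)
  have "P = (1 + of_real s) / (1 - w) - of_real s + of_real m * (1 / (1 - w) - 1 / (1 + of_real s * w))"
  proof -
    \<comment> \<open>Partial fractions: \<open>w * (1 + s) = y - x\<close> and
      \<open>y = (1 + s) - s * x\<close> split the expression into 1/x and 1/y, whose real parts are
      controlled separately.\<close>
    define x y where "x = 1 - w" and "y = 1 + of_real s * w"
    have nz: "x \<noteq> 0" "y \<noteq> 0" using nz1 nz2 by (auto simp: x_def y_def)
    have "P * x * y = y\<^sup>2 + of_real m * w * (1 + of_real s)"
      using P nz unfolding x_def[symmetric] y_def[symmetric]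
      by (simp add: field_simps power2_eq_square)
    moreover have "w * (1 + of_real s) = y - x" "y = (1 + of_real s) - of_real s * x"
      by (simp_all add: x_def y_def algebra_simps)
    ultimately have "P * x * y = y * ((1 + of_real s) - of_real s * x) + of_real m * (y - x)"
      by (metis mult.assoc power2_eq_square)
    moreover have "\<dots> = ((1 + of_real s) / x - of_real s + of_real m * (1 / x - 1 / y)) * x * y"
      using nz by (simp add: field_simps)
    ultimately have "P = (1 + of_real s) / x - of_real s + of_real m * (1 / x - 1 / y)"
      using nz by simp
    then show ?thesis by (simp only: x_def y_def)
  qed
  then have "Re P = (1 + s) * Re (1 / (1 - w)) - s + m * (Re (1 / (1 - w)) - Re (1 / (1 + of_real s * w)))"
  proof -
    define X Y where "X = 1 / (1 - w)" and "Y = 1 / (1 + of_real s * w)"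
    assume "P = (1 + of_real s) / (1 - w) - of_real s + of_real m * (1 / (1 - w) - 1 / (1 + of_real s * w))"
    then have "P = of_real (1 + s) * X - of_real s + of_real m * (X - Y)"
      by (simp add: X_def Y_def)
    then have "Re P = (1 + s) * Re X - s + m * (Re X - Re Y)"
      by (simp del: of_real_add)
    then show ?thesis by (simp only: X_def Y_def)
  qed
  \<comment> \<open>The map 1/(1 - w) sends the unit circle without 1 into the line Re =
    1/2.\<close>
  moreover have "Re (1 / (1 - w)) = 1 / 2"
    using w1 Rew by (simp add: Re_divide power2_eq_square field_simps)
  \<comment> \<open>The bound is the value at w = -1, the minimum on the unit circle because s \<le>
    0, that is \<alpha> \<ge> 1/2. After clearing denominators the gap is -s(1 + s)(1 + Re
    w).\<close>
  moreover have "1 / (1 - s) \<le> Re (1 / (1 + of_real s * w))"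
  proof -
    have eq: "Re (1 / (1 + of_real s * w)) = (1 + s * Re w) / (1 + 2 * s * Re w + s\<^sup>2)"
    proof -
      have "(1 + s * Re w)\<^sup>2 + (s * Im w)\<^sup>2 = 1 + 2 * s * Re w + s\<^sup>2 * ((Re w)\<^sup>2 + (Im w)\<^sup>2)"
        by (simp add: power2_eq_square algebra_simps)
      then show ?thesis using w1 by (simp add: Re_divide)
    qed
    have "0 < (norm (1 + of_real s * w))\<^sup>2" using nz2 by simp
    also have "\<dots> = 1 + 2 * s * Re w + s\<^sup>2 * ((Re w)\<^sup>2 + (Im w)\<^sup>2)"
      unfolding cmod_power2 by (simp add: power2_eq_square algebra_simps)
    finally have pos: "0 < 1 + 2 * s * Re w + s\<^sup>2" using w1 by simp
    have "0 \<le> (- s) * (1 + s) * (1 + Re w)"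
      using s Rew' by (intro mult_nonneg_nonneg) auto
    then have "1 + 2 * s * Re w + s\<^sup>2 \<le> (1 + s * Re w) * (1 - s)"
      by (simp add: power2_eq_square algebra_simps)
    then have "(1 + 2 * s * Re w + s\<^sup>2) / (1 - s) \<le> 1 + s * Re w"
      using s by (subst pos_divide_le_eq) auto
    then show ?thesis
      unfolding eq by (subst pos_le_divide_eq[OF pos]) simp
  qed
  ultimately have "Re P \<le> (1 + s) / 2 - s + m * (1 / 2 - 1 / (1 - s))"
    using assms(5) mult_left_mono[of "1/2 - Re (1 / (1 + of_real s * w))" "1 / 2 - 1 / (1 - s)" m]
    by simp
  also have "\<dots> = (1 - s) / 2 - m * (1 + s) / (2 * (1 - s))"
    using s by (simp add: field_simps)
  finally show ?thesis .
qed

section \<open>The first contact point and the Moebius change of variable\<close>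

text \<open>A point of least modulus where \<open>k\<close> is nonpositive works: \<open>k\<close>
  is positive at all smaller moduli, so continuity forces the value 0 there.\<close>

lemma first_contact:
  fixes k :: "complex \<Rightarrow> real"
  assumes cont: "continuous_on (ball 0 1) k" and k0: "0 < k 0"
    and z1: "norm z1 < 1" "k z1 \<le> 0"
  obtains z0 where "norm z0 < 1" "z0 \<noteq> 0" "k z0 = 0" "\<And>z. norm z < norm z0 \<Longrightarrow> 0 < k z"
proof -
  \<comment> \<open>Restricting to the closed disc through \<open>z1\<close> makes the set closed in
    the plane, although \<open>k\<close> is continuous only on the open disc.\<close>
  define E where "E = {z \<in> cball 0 (norm z1). k z \<le> 0}"
  have contC: "continuous_on (cball 0 (norm z1)) k"
    using z1(1) by (intro continuous_on_subset[OF cont]) auto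
  have "closed E"
  proof -
    have "E = cball 0 (norm z1) \<inter> k -` {..0}" by (auto simp: E_def)
    then show ?thesis using continuous_closed_preimage[OF contC closed_cball closed_atMost] by simp
  qed
  moreover have "E \<noteq> {}" using z1 by (auto simp: E_def)
  ultimately obtain z0 where z0: "z0 \<in> E" "\<And>y. y \<in> E \<Longrightarrow> norm z0 \<le> norm y"
    using distance_attains_inf[of E 0] by (metis dist_0_norm)
  have n0: "norm z0 \<le> norm z1" "k z0 \<le> 0" using z0(1) by (auto simp: E_def)
  have nz: "z0 \<noteq> 0" using n0 k0 by auto
  have pos: "0 < k z" if "norm z < norm z0" for z
    using z0(2)[of z] that n0 by (force simp: E_def)
  have "0 \<le> k z0"
  proof (rule continuous_ge_on_closure[of "ball 0 (norm z0)" k])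
    show "continuous_on (closure (ball 0 (norm z0))) k"
      using nz n0 z1 by (auto intro!: continuous_on_subset[OF cont])
    show "z0 \<in> closure (ball 0 (norm z0))" using nz by simp
    show "0 \<le> k x" if "x \<in> ball 0 (norm z0)" for x
      using pos[of x] that by simp
  qed
  then have "k z0 = 0" using n0 by simp
  moreover have "norm z0 < 1" using n0 z1 by simp
  ultimately show thesis using nz pos that by blast
qed

text \<open>With s = 1 - 2\<alpha> and w = (1 - u)/(1 + su), this relates |w| < 1 to Re u >
  \<alpha>|u|^2, a division-free form of Re (1/u) > \<alpha> that also makes sense at u = 0.\<close>

lemma norm_Moebius_diff:
  "(norm (1 + of_real s * u))\<^sup>2 - (norm (1 - u :: complex))\<^sup>2
     = 2 * (1 + s) * (Re u - (1 - s) / 2 * (norm u)\<^sup>2)"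
  unfolding cmod_power2 by (simp add: power2_eq_square field_simps)

lemma norm_Moebius_less_iff:
  assumes "-1 < s"
  shows "norm (1 - u :: complex) < norm (1 + of_real s * u) \<longleftrightarrow> 0 < Re u - (1 - s) / 2 * (norm u)\<^sup>2"
proof -
  have "norm (1 - u) < norm (1 + of_real s * u) \<longleftrightarrow> (norm (1 - u))\<^sup>2 < (norm (1 + of_real s * u))\<^sup>2"
    by (simp add: power_mono_iff flip: not_le)
  also have "\<dots> \<longleftrightarrow> 0 < 2 * (1 + s) * (Re u - (1 - s) / 2 * (norm u)\<^sup>2)"
    unfolding norm_Moebius_diff[symmetric] by simp
  finally have "norm (1 - u) < norm (1 + of_real s * u) \<longleftrightarrow> 0 < 2 * (1 + s) * (Re u - (1 - s) / 2 * (norm u)\<^sup>2)" .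
  then show ?thesis using assms by (simp add: zero_less_mult_iff)
qed

lemma norm_Moebius_eq_iff:
  assumes "-1 < s"
  shows "norm (1 - u :: complex) = norm (1 + of_real s * u) \<longleftrightarrow> Re u - (1 - s) / 2 * (norm u)\<^sup>2 = 0"
proof -
  have "norm (1 - u) = norm (1 + of_real s * u) \<longleftrightarrow> 2 * (1 + s) * (Re u - (1 - s) / 2 * (norm u)\<^sup>2) = 0"
    unfolding norm_Moebius_diff[symmetric] by auto
  then show ?thesis using assms by simp
qed

section \<open>The quotient f/(z f') and its differential equation\<close>

text \<open>Take u = g/f' with f = z g, which fills in the singularity at 0. Differentiating f = z u
  f' and dividing by f' gives the equation for \<open>u\<close>; differentiating that equation at 0
  gives u'(0).\<close>

lemma convex_quotient:
  assumes holf: "f holomorphic_on ball 0 1" and f0: "f 0 = 0" and f1: "deriv f 0 = 1"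
    and nz: "\<And>z. norm z < 1 \<Longrightarrow> deriv f z \<noteq> 0"
  obtains u where "u holomorphic_on ball 0 1" "u 0 = 1"
    "\<And>z. norm z < 1 \<Longrightarrow> f z = z * u z * deriv f z"
    "\<And>z. norm z < 1 \<Longrightarrow> (1 + z * deriv (deriv f) z / deriv f z) * u z = 1 - z * deriv u z"
    "deriv u 0 = - deriv (deriv f) 0 / 2"
proof -
  obtain g where g: "g holomorphic_on ball 0 1" "\<And>z. norm z < 1 \<Longrightarrow> f z = z * g z" "deriv f 0 = g 0"
    using Schwarz3[OF holf f0] by metis
  have holf': "deriv f holomorphic_on ball 0 1"
    using holf by (intro holomorphic_deriv) auto
  define u where "u z = g z / deriv f z" for z
  have holu: "u holomorphic_on ball 0 1"
    unfolding u_def using g(1) holf holf' nz by (intro holomorphic_intros) auto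
  have u0: "u 0 = 1" using g(3) f1 by (simp add: u_def)
  have fu: "f z = z * u z * deriv f z" if "norm z < 1" for z
    using g(2)[OF that] nz[OF that] by (simp add: u_def)
  have ode: "(1 + z * deriv (deriv f) z / deriv f z) * u z = 1 - z * deriv u z" if z: "norm z < 1" for z
  proof -
    have du: "(u has_field_derivative deriv u z) (at z)"
      and df': "(deriv f has_field_derivative deriv (deriv f) z) (at z)"
      using holf holu holf' z by (auto intro!: holomorphic_derivI[of _ "ball 0 1"])
    have "((\<lambda>z. z * u z * deriv f z) has_field_derivative
        ((u z + z * deriv u z) * deriv f z + z * u z * deriv (deriv f) z)) (at z)"
      by (rule derivative_eq_intros du df' refl | simp add: algebra_simps)+
    then have "(f has_field_derivative
        ((u z + z * deriv u z) * deriv f z + z * u z * deriv (deriv f) z)) (at z)"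
      by (rule has_field_derivative_transform_within_open[of _ _ _ "ball 0 1"]) (use z fu in auto)
    then have "deriv f z = (u z + z * deriv u z) * deriv f z + z * u z * deriv (deriv f) z"
      by (rule DERIV_imp_deriv)
    then show ?thesis
      using nz[OF z] by (simp add: field_simps)
  qed
  have "deriv u 0 = - deriv (deriv f) 0 / 2"
  proof -
    let ?P = "\<lambda>z. 1 + z * deriv (deriv f) z / deriv f z"
    have hol2: "deriv (deriv f) holomorphic_on ball 0 1"
      using holf holf' by (intro holomorphic_deriv) auto
    have du: "(u has_field_derivative deriv u 0) (at 0)"
      and d2u: "(deriv u has_field_derivative deriv (deriv u) 0) (at 0)"
      and df': "(deriv f has_field_derivative deriv (deriv f) 0) (at 0)"
      and df'': "(deriv (deriv f) has_field_derivative deriv (deriv (deriv f)) 0) (at 0)"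
      using holf holu holf' hol2 holomorphic_deriv[OF holu]
      by (auto intro!: holomorphic_derivI[of _ "ball 0 1"])
    \<comment> \<open>Here P(0) = u(0) = 1 and P'(0) = f''(0), so the product rule gives f''(0) +
      u'(0); the right-hand side of the equation has derivative -u'(0).\<close>
    have "((\<lambda>z. ?P z * u z) has_field_derivative (deriv (deriv f) 0 + deriv u 0)) (at 0)"
      using f1 u0 by (auto intro!: derivative_eq_intros du df' df'')
    then have "((\<lambda>z. 1 - z * deriv u z) has_field_derivative (deriv (deriv f) 0 + deriv u 0)) (at 0)"
      by (rule has_field_derivative_transform_within_open[of _ _ _ "ball 0 1"]) (use ode in auto)
    moreover have "((\<lambda>z. 1 - z * deriv u z) has_field_derivative (- deriv u 0)) (at 0)"
      by (auto intro!: derivative_eq_intros d2u)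
    ultimately have "deriv (deriv f) 0 + deriv u 0 = - deriv u 0"
      by (rule DERIV_unique)
    then have "deriv (deriv f) 0 = - (2 * deriv u 0)"
      by (simp add: algebra_simps add_eq_0_iff)
    then show ?thesis by simp
  qed
  with holu u0 fu ode show thesis by (rule that)
qed

text \<open>The contact argument is run with the barrier \<open>k\<close> rather than |w|:
  \<open>k\<close> is continuous on the whole disc, whereas \<open>w\<close> may have poles. In the
  application \<open>norm (deriv u 0)\<close> is |a_2|.\<close>

lemma Re_quotient_gt_of_ode:
  fixes u P :: "complex \<Rightarrow> complex" and \<alpha> :: real
  assumes holu: "u holomorphic_on ball 0 1" and u0: "u 0 = 1"
    and ode: "\<And>z. norm z < 1 \<Longrightarrow> P z * u z = 1 - z * deriv u z"
    and pos: "\<And>z. norm z < 1 \<Longrightarrow> 0 < Re (P z)"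
    and \<alpha>: "1/2 \<le> \<alpha>" "\<alpha> < 1"
    and root: "0 \<le> 2 * \<alpha>^3 - \<alpha>\<^sup>2 * norm (deriv u 0) - 4 * \<alpha> + 2"
    and z: "norm z < 1"
  shows "0 < Re (u z) - \<alpha> * (norm (u z))\<^sup>2"
proof (rule ccontr)
  define k where "k z = Re (u z) - \<alpha> * (norm (u z))\<^sup>2" for z
  assume "\<not> 0 < Re (u z) - \<alpha> * (norm (u z))\<^sup>2"
  then have "k z \<le> 0" by (simp add: k_def)
  moreover have "continuous_on (ball 0 1) k"
    unfolding k_def using holu by (intro continuous_intros holomorphic_on_imp_continuous_on)
  moreover have "0 < k 0" using u0 \<alpha> by (simp add: k_def)
  ultimately obtain z0 where z0: "norm z0 < 1" "z0 \<noteq> 0" "k z0 = 0"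
      "\<And>z. norm z < norm z0 \<Longrightarrow> 0 < k z"
    using first_contact z by metis
  define s where "s = 1 - 2 * \<alpha>"
  have s: "-1 < s" "s \<le> 0" and \<alpha>s: "\<alpha> = (1 - s) / 2" using \<alpha> by (auto simp: s_def)
  have s1: "1 + complex_of_real s \<noteq> 0"
    using s by (simp add: complex_eq_iff)
  define S where "S = {z \<in> ball 0 1. 1 + of_real s * u z \<noteq> 0}"
  define w where "w z = (1 - u z) / (1 + of_real s * u z)" for z
  have S: "open S"
  proof -
    have "continuous_on (ball 0 1) (\<lambda>z. 1 + of_real s * u z)"
      using holu by (intro continuous_intros holomorphic_on_imp_continuous_on)
    from continuous_open_preimage[OF this open_ball open_Compl[OF closed_singleton[of 0]]]
    show ?thesis by (simp add: S_def vimage_def Int_def)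
  qed
  \<comment> \<open>For k \<ge> 0, a zero of 1 + su would force 1 - u = 0 as well, hence u = 1 and s
    = -1. So \<open>w\<close> has no pole up to the contact circle.\<close>
  have Seq: "z \<in> S" if "norm z < 1" "0 < k z \<or> k z = 0" for z
  proof -
    have "norm (1 - u z) \<le> norm (1 + of_real s * u z)"
      using that norm_Moebius_less_iff[OF s(1), of "u z"] norm_Moebius_eq_iff[OF s(1), of "u z"]
      by (auto simp: k_def \<alpha>s)
    then have "1 + of_real s * u z \<noteq> 0" using s1 by auto
    then show ?thesis using that by (simp add: S_def)
  qed
  have holw: "w holomorphic_on S"
    unfolding w_def
    by (intro holomorphic_intros holomorphic_on_subset[OF holu]) (auto simp: S_def)
  have k_cball: "0 \<le> k z" if "norm z \<le> norm z0" for z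
  proof (rule continuous_ge_on_closure[of "ball 0 (norm z0)" k])
    show "continuous_on (closure (ball 0 (norm z0))) k"
      unfolding k_def using z0(1,2)
      by (auto intro!: continuous_intros holomorphic_on_imp_continuous_on holomorphic_on_subset[OF holu])
    show "z \<in> closure (ball 0 (norm z0))" using that z0(2) by simp
    show "0 \<le> k x" if "x \<in> ball 0 (norm z0)" for x
      using z0(4)[of x] that by simp
  qed
  have cball: "cball 0 (norm z0) \<subseteq> S"
  proof
    fix z :: complex assume "z \<in> cball 0 (norm z0)"
    then show "z \<in> S" using k_cball[of z] z0(1) by (intro Seq) auto
  qed
  have lt: "norm (w z) < 1" if "norm z < norm z0" for z
  proof -
    have "norm (1 - u z) < norm (1 + of_real s * u z)"
      using z0(4)[OF that] norm_Moebius_less_iff[OF s(1), of "u z"] by (simp add: k_def \<alpha>s)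
    moreover have "0 < norm (1 + of_real s * u z)"
      using calculation by (meson le_less_trans norm_ge_zero)
    ultimately show ?thesis
      by (simp add: w_def norm_divide)
  qed
  have z0S: "z0 \<in> S" and zS: "0 \<in> S" using cball by auto
  have eq1: "norm (w z0) = 1"
  proof -
    have "norm (1 - u z0) = norm (1 + of_real s * u z0)"
      using z0(3) norm_Moebius_eq_iff[OF s(1), of "u z0"] by (simp add: k_def \<alpha>s)
    then show ?thesis
      using z0S by (simp add: w_def norm_divide S_def)
  qed
  obtain m :: real where m: "m \<ge> 2 / (1 + norm z0 * norm (deriv w 0))" "z0 * deriv w z0 = of_real m * w z0"
  proof (rule Jack_lemma_second_coefficient[OF holw S cball z0(2) _ lt eq1])
    show "w 0 = 0" using u0 by (simp add: w_def)
  qed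
  have dw: "deriv w z = - (1 + of_real s) * deriv u z / (1 + of_real s * u z)\<^sup>2" if "z \<in> S" for z
  proof -
    have nz: "1 + of_real s * u z \<noteq> 0" and z: "z \<in> ball 0 1" using that by (auto simp: S_def)
    have du: "(u has_field_derivative deriv u z) (at z)"
      using holu z by (intro holomorphic_derivI[of _ "ball 0 1"]) auto
    have "(w has_field_derivative (- (1 + of_real s) * deriv u z / (1 + of_real s * u z)\<^sup>2)) (at z)"
      unfolding w_def
      by (rule derivative_eq_intros du refl nz | (simp add: field_simps power2_eq_square))+
    then show ?thesis by (rule DERIV_imp_deriv)
  qed
  define b where "b = norm (deriv u 0)"
  have dw0: "norm (deriv w 0) = b / (1 + s)"
  proof -
    have "deriv w 0 = - (deriv u 0 / (1 + of_real s))"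
    proof -
      have "deriv w 0 = - ((1 + of_real s) * deriv u 0 / ((1 + of_real s) * (1 + of_real s)))"
        using dw[OF zS] u0 by (simp only: power2_eq_square mult_1_right minus_mult_left minus_divide_left)
      also have "\<dots> = - (deriv u 0 / (1 + of_real s))"
        by (simp only: mult_divide_mult_cancel_left[OF s1])
      finally show ?thesis .
    qed
    moreover have "norm (1 + complex_of_real s) = 1 + s"
      using s norm_of_real[of "1 + s", where 'a = complex] by simp
    ultimately show ?thesis by (simp add: b_def norm_divide)
  qed
  have b: "0 \<le> b" by (simp add: b_def)
  \<comment> \<open>Replacing \<open>norm z0\<close> by 1 weakens the lower bound to one that no
    longer depends on the contact point.\<close>
  have m2: "m \<ge> 2 * (1 + s) / (1 + s + b)"
  proof -
    have "norm z0 * (b / (1 + s)) \<le> 1 * (b / (1 + s))"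
      using z0(1) b s by (intro mult_right_mono) auto
    then have "2 / (1 + b / (1 + s)) \<le> 2 / (1 + norm z0 * norm (deriv w 0))"
      unfolding dw0 using b s by (intro divide_left_mono mult_pos_pos add_pos_nonneg) auto
    moreover have "2 / (1 + b / (1 + s)) = 2 * (1 + s) / (1 + s + b)"
      using s by (simp add: field_simps)
    ultimately show ?thesis using m(1) by linarith
  qed
  then have m0: "0 \<le> m"
    using b s by (intro order_trans[OF _ m2]) auto
  \<comment> \<open>The Moebius map (1 - u)/(1 + su) is an involution, so the same formula recovers
    \<open>u\<close> from \<open>w\<close>.\<close>
  have inv: "(1 + of_real s * u z0) * (1 + of_real s * w z0) = 1 + of_real s"
    "u z0 = (1 - w z0) / (1 + of_real s * w z0)"
  proof -
    have nz: "1 + of_real s * u z0 \<noteq> 0" using z0S by (simp add: S_def)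
    then show *: "(1 + of_real s * u z0) * (1 + of_real s * w z0) = 1 + of_real s"
      by (simp add: w_def field_simps)
    have "1 + of_real s * w z0 \<noteq> 0" using * s1 by auto
    moreover have "u z0 * (1 + of_real s * w z0) = 1 - w z0"
      using nz by (simp add: w_def field_simps)
    ultimately show "u z0 = (1 - w z0) / (1 + of_real s * w z0)"
      by (simp add: field_simps)
  qed
  \<comment> \<open>Jack's relation for w' is rewritten for u', using x y = 1 + s to trade the
    denominator in \<open>u\<close> for the one in \<open>w\<close>.\<close>
  have du0: "z0 * deriv u z0 = - (of_real m * w z0 * (1 + of_real s)) / (1 + of_real s * w z0)\<^sup>2"
  proof -
    define x y where "x = 1 + of_real s * u z0" and "y = 1 + of_real s * w z0"
    have xy: "x * y = 1 + of_real s" "x \<noteq> 0" "y \<noteq> 0" using inv(1) s1 by (auto simp: x_def y_def)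
    have "of_real m * w z0 = - (x * y) * (z0 * deriv u z0) / x\<^sup>2"
      unfolding m(2)[symmetric] dw[OF z0S] xy(1) unfolding x_def
      by (simp only: times_divide_eq_right mult.left_commute)
    then have "z0 * deriv u z0 = - (of_real m * w z0 * (x * y)) / y\<^sup>2"
      using xy(2,3) by (simp add: field_simps power2_eq_square)
    then show ?thesis using xy(1) by (simp add: y_def)
  qed
  have ode0: "P z0 * ((1 - w z0) / (1 + of_real s * w z0))
      = 1 + of_real m * w z0 * (1 + of_real s) / (1 + of_real s * w z0)\<^sup>2"
    using ode[OF z0(1)] unfolding inv(2)[symmetric] du0 by simp
  show False
  proof (cases "w z0 = 1")
    case True  \<comment> \<open>$u(z_0) = 0$, a pole of $z f'/f$\<close>
    have "0 = 1 + of_real m * (1 + of_real s) / (1 + complex_of_real s)\<^sup>2"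
      using ode0 unfolding True by simp
    also have "\<dots> = of_real (1 + m / (1 + s))"
      using s1 by (simp add: power2_eq_square)
    finally have "1 + m / (1 + s) = 0" by (metis of_real_eq_0_iff)
    moreover have "0 \<le> m / (1 + s)" using m0 s by simp
    ultimately show False by linarith
  next
    case False
    have "Re (P z0) \<le> (1 - s) / 2 - m * (1 + s) / (2 * (1 - s))"
      using Re_boundary_le[OF eq1 False s m0 ode0] .
    also have "\<dots> \<le> 0"
    proof -
      \<comment> \<open>With s = 1 - 2\<alpha> this reads \<alpha>^2 (2(1 - \<alpha>) + b) \<le> 2(1
        - \<alpha>)^2 after division by 4; the terms 2\<alpha>^2 cancel and the cubic inequality
        \<open>root\<close> remains.\<close>
      have "(1 - s)\<^sup>2 * (1 + s + b) \<le> 2 * (1 + s)\<^sup>2"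
        using root unfolding \<alpha>s b_def[symmetric] by (simp add: power2_eq_square power3_eq_cube field_simps)
      then have "(1 - s)\<^sup>2 \<le> 2 * (1 + s) / (1 + s + b) * (1 + s)"
        using b s by (simp add: field_simps power2_eq_square)
      also have "\<dots> \<le> m * (1 + s)"
        using m2 s by (intro mult_right_mono) auto
      finally show ?thesis using s by (simp add: field_simps power2_eq_square)
    qed
    finally show False using pos[OF z0(1)] by simp
  qed
qed

section \<open>The cubic equation\<close>

text \<open>The cubic is (1 - b)/4 \<ge> 0 at 1/2 and -2/27 - 4b/9 < 0 at 2/3, so it has a root
  between. A smaller positive root is impossible because difference quotients on (0, 2/3] are
  negative.\<close>

lemma exists_least_root:
  fixes b :: real
  assumes b: "0 \<le> b" "b \<le> 1"
  obtains \<alpha> :: real where "1/2 \<le> \<alpha>" "\<alpha> \<le> 2/3" "2 * \<alpha>^3 - \<alpha>\<^sup>2 * b - 4 * \<alpha> + 2 = 0"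
    "\<And>\<beta>. 0 < \<beta> \<Longrightarrow> 2 * \<beta>^3 - \<beta>\<^sup>2 * b - 4 * \<beta> + 2 = 0 \<Longrightarrow> \<alpha> \<le> \<beta>"
proof -
  define g where "g x = 2 * x^3 - x\<^sup>2 * b - 4 * x + 2" for x :: real
  have "\<exists>x. 1/2 \<le> x \<and> x \<le> 2/3 \<and> g x = 0"
  proof (rule IVT2')
    show "continuous_on {1/2..2/3} g" unfolding g_def by (intro continuous_intros)
  qed (use b in \<open>auto simp: g_def power3_eq_cube power2_eq_square\<close>)
  then obtain \<alpha> where \<alpha>: "1/2 \<le> \<alpha>" "\<alpha> \<le> 2/3" "g \<alpha> = 0" by blast
  have "\<alpha> \<le> \<beta>" if "0 < \<beta>" "g \<beta> = 0" for \<beta>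
  proof (rule ccontr)
    assume lt: "\<not> \<alpha> \<le> \<beta>"
    \<comment> \<open>Each of the three products is at most 4/9, so the quadratic part of the
      difference quotient is at most 8/3, below the 4 that is subtracted.\<close>
    have "\<beta> * \<beta> \<le> 2/3 * (2/3)" "\<alpha> * \<alpha> \<le> 2/3 * (2/3)" "\<alpha> * \<beta> \<le> 2/3 * (2/3)"
      using lt that(1) \<alpha>(1,2) by (intro mult_mono; simp)+
    moreover have "0 \<le> b * (\<alpha> + \<beta>)" using b that(1) \<alpha>(1) by simp
    ultimately have "2 * (\<beta> * \<beta> + \<alpha> * \<beta> + \<alpha> * \<alpha>) - b * (\<alpha> + \<beta>) - 4 < 0" by simp
    then have "0 < (\<beta> - \<alpha>) * (2 * (\<beta> * \<beta> + \<alpha> * \<beta> + \<alpha> * \<alpha>) - b * (\<alpha> + \<beta>) - 4)"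
      using lt by (intro mult_neg_neg) auto
    also have "\<dots> = g \<beta> - g \<alpha>"
      by (simp add: g_def power3_eq_cube power2_eq_square algebra_simps)
    finally show False using that(2) \<alpha>(3) by simp
  qed
  with \<alpha> show thesis by (intro that[of \<alpha>]) (auto simp: g_def)
qed

section \<open>The order of starlikeness of a convex function\<close>

theorem theorem5p1:
  fixes f :: "complex \<Rightarrow> complex" and a :: "nat \<Rightarrow> complex"
  assumes "normalized_expansion f a"
    and "f \<in> convex_functions"
  shows "\<exists>\<alpha>::real. 1/2 \<le> \<alpha> \<and> \<alpha> \<le> 2/3
           \<and> 2 * \<alpha>^3 - \<alpha>^2 * cmod (a 2) - 4 * \<alpha> + 2 = 0
           \<and> (\<forall>\<beta>>0. 2 * \<beta>^3 - \<beta>^2 * cmod (a 2) - 4 * \<beta> + 2 = 0 \<longrightarrow> \<alpha> \<le> \<beta>)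
           \<and> f \<in> starlike_functions \<alpha>"
proof -
  define P where "P z = 1 + z * deriv (deriv f) z / deriv f z" for z
  have norm_f: "f \<in> normalized_functions"
    and nz: "\<And>z. norm z < 1 \<Longrightarrow> deriv f z \<noteq> 0"
    and pos: "\<And>z. norm z < 1 \<Longrightarrow> 0 < Re (P z)"
    using assms(2) by (auto simp: convex_functions_def P_def)
  have holf: "f holomorphic_on ball 0 1"
    using norm_f by (auto simp: normalized_functions_def analytic_imp_holomorphic)
  \<comment> \<open>Uniqueness of the power series identifies \<open>a\<close> with the Taylor
    coefficients of \<open>f\<close>, so that a_2 = f''(0)/2.\<close>
  have "f has_fps_expansion Abs_fps a"
  proof (rule has_fps_expansionI)
    have "eventually (\<lambda>u::complex. u \<in> ball 0 1) (nhds 0)"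
      by (rule eventually_nhds_in_open) auto
    then show "\<forall>\<^sub>F u in nhds 0. (\<lambda>n. fps_nth (Abs_fps a) n * u ^ n) sums f u"
      by eventually_elim (use assms(1) in \<open>auto simp: normalized_expansion_def\<close>)
  qed
  from fps_nth_fps_expansion[OF this]
  have a: "a n = (deriv ^^ n) f 0 / fact n" for n by simp
  have f0: "f 0 = 0" and f1: "deriv f 0 = 1" and a2: "a 2 = deriv (deriv f) 0 / 2"
    using a[of 0] a[of 1] a[of 2] assms(1) by (auto simp: normalized_expansion_def eval_nat_numeral)
  obtain u where u: "u holomorphic_on ball 0 1" "u 0 = 1"
    "\<And>z. norm z < 1 \<Longrightarrow> f z = z * u z * deriv f z"
    "\<And>z. norm z < 1 \<Longrightarrow> P z * u z = 1 - z * deriv u z"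
    "deriv u 0 = - deriv (deriv f) 0 / 2"
    using convex_quotient[OF holf f0 f1 nz] unfolding P_def by metis
  have du0: "norm (deriv u 0) = cmod (a 2)"
    unfolding u(5) a2 by (simp add: norm_divide)

  \<comment> \<open>P'(0) = f''(0) = 2 a_2, so the coefficient bound for positive real part applies.
    This inequality is what places a root in [1/2, 2/3].\<close>
  have "cmod (a 2) \<le> 1"
  proof -
    have hol1: "deriv f holomorphic_on ball 0 1" and hol2: "deriv (deriv f) holomorphic_on ball 0 1"
      using holf by (auto intro!: holomorphic_deriv)
    have "P holomorphic_on ball 0 1"
      unfolding P_def using holf hol1 hol2 nz by (intro holomorphic_intros) auto
    moreover have "P 0 = 1" by (simp add: P_def)
    ultimately have "norm (deriv P 0) \<le> 2"
      using pos by (rule Caratheodory_coefficient_bound)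
    moreover have "deriv P 0 = deriv (deriv f) 0"
    proof -
      have d1: "(deriv f has_field_derivative deriv (deriv f) 0) (at 0)"
        and d2: "(deriv (deriv f) has_field_derivative deriv (deriv (deriv f)) 0) (at 0)"
        using holf hol1 hol2 by (auto intro!: holomorphic_derivI[of _ "ball 0 1"])
      have "(P has_field_derivative deriv (deriv f) 0) (at 0)"
        unfolding P_def using f1 by (auto intro!: derivative_eq_intros d1 d2)
      then show ?thesis by (rule DERIV_imp_deriv)
    qed
    ultimately show ?thesis unfolding a2 by (simp add: norm_divide)
  qed
  then obtain \<alpha> :: real where \<alpha>: "1/2 \<le> \<alpha>" "\<alpha> \<le> 2/3" "2 * \<alpha>^3 - \<alpha>\<^sup>2 * cmod (a 2) - 4 * \<alpha> + 2 = 0"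
    "\<And>\<beta>. 0 < \<beta> \<Longrightarrow> 2 * \<beta>^3 - \<beta>\<^sup>2 * cmod (a 2) - 4 * \<beta> + 2 = 0 \<Longrightarrow> \<alpha> \<le> \<beta>"
    using exists_least_root[of "cmod (a 2)"] by auto

  have "f z \<noteq> 0 \<and> Re (z * deriv f z / f z) > \<alpha>" if z: "norm z < 1" "z \<noteq> 0" for z
  proof -
    \<comment> \<open>This both excludes u z = 0 and, divided by |u z|^2, says Re (1/u z) >
      \<alpha>, where 1/u = z f'/f.\<close>
    have k: "0 < Re (u z) - \<alpha> * (norm (u z))\<^sup>2"
      by (rule Re_quotient_gt_of_ode[OF u(1,2,4) pos]) (use \<alpha> z du0 in auto)
    then have uz: "u z \<noteq> 0" by auto
    then have "z * deriv f z / f z = 1 / u z" and "f z \<noteq> 0"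
      using u(3)[OF z(1)] z nz[OF z(1)] by (simp_all add: field_simps)
    moreover have "Re (1 / u z) = Re (u z) / (norm (u z))\<^sup>2"
      by (simp add: Re_divide cmod_power2)
    moreover have "\<alpha> < Re (u z) / (norm (u z))\<^sup>2"
      using k uz by (simp add: pos_less_divide_eq)
    ultimately show ?thesis by simp
  qed
  then have "f \<in> starlike_functions \<alpha>"
    using norm_f by (auto simp: starlike_functions_def)
  with \<alpha> show ?thesis by blast
qed

end
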